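(* A closed set $\varnothing\neq M\subset\mathbb{R}^2$ belongs to $\mathcal{D}_2$ if and only if (i) each component of $M$ belongs to $\mathcal{D}_2$, and (ii) the system of all components of $M$ is discrete.
   Context: A function on an open convex set $C\subset\mathbb{R}^d$ is DC if it is the difference of two convex functions on $C$. $\mathcal{D}_2$ denotes the family consisting of $\varnothing$ together with all nonempty closed sets $A\subset\mathbb{R}^2$ whose distance function $d_A=\operatorname{dist}(\cdot,A)$ is DC on $\mathbb{R}^2$. A system $\mathcal{A}$ of subsets of $\mathbb{R}^2$ is discrete if each $z\in\mathbb{R}^2$ has a neighbourhood which intersects at most one member of $\mathcal{A}$. *)

theory Defs
  imports "HOL-Analysis.Analysis"
begin

definition DC_on :: "'a::real_vector set \<Rightarrow> ('a \<Rightarrow> real) \<Rightarrow> bool" where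
  "DC_on C f \<longleftrightarrow> (\<exists>g h. convex_on C g \<and> convex_on C h \<and> (\<forall>x\<in>C. f x = g x - h x))"

definition D2 :: "(real^2) set set" where
  "D2 = {{}} \<union> {A. A \<noteq> {} \<and> closed A \<and> DC_on UNIV (\<lambda>x. infdist x A)}"

definition discrete_system :: "'a::topological_space set set \<Rightarrow> bool" where
  "discrete_system \<A> \<longleftrightarrow> (\<forall>z. \<exists>U. open U \<and> z \<in> U \<and>
      (\<forall>A\<in>\<A>. \<forall>B\<in>\<A>. U \<inter> A \<noteq> {} \<longrightarrow> U \<inter> B \<noteq> {} \<longrightarrow> A = B))"

end

theory Submission
  imports Defs
begin

text \<open>
  Discreteness of the components is forced by uniform one-sided differentiability. If \<open>h\<close> is convex,
  then \<open>h (z + 2x) - 2 h (z + x) + h z\<close> is \<open>o(\<parallel>x\<parallel>)\<close>. Suppose \<open>d\<^sub>M = g - h\<close>, \<open>z \<in> M\<close>, and a point \<open>w \<in> M\<close>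
  close to \<open>z\<close> lies in another component. Splitting \<open>M \<inter> cball z (dist z w)\<close> into two disjoint
  compact pieces and taking the point \<open>p\<close> nearest to \<open>z\<close> in the piece containing \<open>w\<close>, the function
  \<open>d\<^sub>M\<close> vanishes at \<open>z\<close> and \<open>p\<close> but has slope \<open>-1\<close> on the segment from \<open>z\<close> just before \<open>p\<close>, which
  contradicts the estimate for \<open>h\<close> at \<open>x = p - z\<close>.

  Once the components are discrete, \<open>d\<^sub>M\<close> and \<open>d\<^sub>C\<close> agree near each point of a component \<open>C\<close>. Away
  from its set a distance function always coincides locally with a DC function, so both remaining
  implications follow from Hartman's theorem that locally DC functions are DC.
\<close>

section \<open>Local regularity of convex functions: Lipschitz bounds and second differences\<close>

text \<open>Prolonging the segment from \<open>x\<close> through \<open>y\<close> by length one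
  stays in \<open>cball z 2\<close>, where \<open>h\<close> is bounded by some \<open>B\<close>;
  convexity along the prolonged segment bounds the slope by \<open>2 * B\<close>.\<close>

lemma convex_on_UNIV_lipschitz_ball:
  fixes h :: "'a::euclidean_space \<Rightarrow> real"
  assumes h: "convex_on UNIV h"
  obtains L where "L > 0" "\<And>x y. x \<in> cball z 1 \<Longrightarrow> y \<in> cball z 1 \<Longrightarrow> h y - h x \<le> L * norm (y - x)"
proof -
  have "continuous_on (cball z 2) h"
    using convex_on_continuous[OF open_UNIV h] continuous_on_subset by blast
  then have "compact (h ` cball z 2)"
    by (intro compact_continuous_image) auto
  then obtain B where "B > 0" and B: "\<And>x. x \<in> cball z 2 \<Longrightarrow> \<bar>h x\<bar> \<le> B"
    by (metis bounded_pos compact_imp_bounded imageI real_norm_def)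
  have "h y - h x \<le> 2 * B * norm (y - x)" if x: "x \<in> cball z 1" and y: "y \<in> cball z 1" for x y
  proof (cases "x = y")
    case False
    define d where "d = norm (y - x)"
    have d: "d > 0" using False by (auto simp: d_def)
    define w where "w = y + (1 / d) *\<^sub>R (y - x)"
    have "norm ((1 / d) *\<^sub>R (y - x)) = \<bar>1 / d\<bar> * d"
      unfolding d_def by (rule norm_scaleR)
    also have "\<dots> = 1" using d by simp
    finally have "dist y w = 1" by (simp add: w_def dist_norm del: norm_scaleR)
    then have "w \<in> cball z 2"
      using y dist_triangle[of z w y] by (simp add: dist_commute)
    then have hw: "\<bar>h w\<bar> \<le> B" by (rule B)
    have hx: "\<bar>h x\<bar> \<le> B" using x by (intro B) simp
    have "y = (1 - d / (1 + d)) *\<^sub>R x + (d / (1 + d)) *\<^sub>R w"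
    proof -
      have "(1 + d) *\<^sub>R y = x + d *\<^sub>R w"
        using d by (simp add: w_def algebra_simps)
      then have "(1 / (1 + d)) *\<^sub>R ((1 + d) *\<^sub>R y) = (1 / (1 + d)) *\<^sub>R (x + d *\<^sub>R w)"
        by simp
      then have "y = (1 / (1 + d)) *\<^sub>R (x + d *\<^sub>R w)"
        using d by simp
      moreover have "1 - d / (1 + d) = 1 / (1 + d)" using d by (simp add: field_simps)
      ultimately show ?thesis by (simp add: scaleR_add_right)
    qed
    then have "h y \<le> (1 - d / (1 + d)) * h x + (d / (1 + d)) * h w"
      using convex_onD[OF h, of "d / (1 + d)" x w] d by simp
    then have "h y - h x \<le> (d / (1 + d)) * (h w - h x)"
      by (simp add: left_diff_distrib right_diff_distrib del: times_divide_eq_left times_divide_eq_right)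
    also have "\<dots> \<le> (d / (1 + d)) * (2 * B)"
      using hw hx d by (intro mult_left_mono) auto
    also have "\<dots> \<le> d * (2 * B)"
      using d \<open>B > 0\<close> by (intro mult_right_mono) (auto simp: field_simps)
    finally show ?thesis by (simp add: d_def algebra_simps)
  qed simp
  with \<open>B > 0\<close> show ?thesis by (intro that[of "2 * B"]) auto
qed

text \<open>By compactness of the unit sphere, the difference quotients at \<open>z\<close> converge to the directional
  derivative uniformly in the direction (Dini).\<close>

lemma convex_on_UNIV_second_difference:
  fixes h :: "'a::euclidean_space \<Rightarrow> real"
  assumes h: "convex_on UNIV h" and e: "e > 0"
  obtains r where "r > 0"
    "\<And>x. x \<noteq> 0 \<Longrightarrow> norm x < r \<Longrightarrow> h (z + 2 *\<^sub>R x) - 2 * h (z + x) + h z < e * norm x"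
proof -
  define k where "k = (\<lambda>x. h (z + x) - h z)"
  obtain L where L: "L > 0" and
    hL: "\<And>x y. x \<in> cball z 1 \<Longrightarrow> y \<in> cball z 1 \<Longrightarrow> h y - h x \<le> L * norm (y - x)"
    using convex_on_UNIV_lipschitz_ball[OF h, of z] by blast
  have kL: "k y - k x \<le> L * norm (y - x)" if "norm x \<le> 1" "norm y \<le> 1" for x y
    using hL[of "z + x" "z + y"] that by (simp add: k_def dist_norm)
  have mono: "k (a *\<^sub>R u) / a \<le> k (b *\<^sub>R u) / b" if "0 < a" "a \<le> b" for a b u
  proof -
    have "z + a *\<^sub>R u = (1 - a / b) *\<^sub>R z + (a / b) *\<^sub>R (z + b *\<^sub>R u)"
      using that by (simp add: algebra_simps)
    then have "h (z + a *\<^sub>R u) \<le> (1 - a / b) * h z + (a / b) * h (z + b *\<^sub>R u)"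
      using convex_onD[OF h, of "a / b" z "z + b *\<^sub>R u"] that by simp
    then have "k (a *\<^sub>R u) \<le> (a / b) * k (b *\<^sub>R u)"
      by (simp add: k_def algebra_simps)
    then show ?thesis using that by (simp add: field_simps)
  qed
  \<comment> \<open>Turning the direction by less than \<delta> changes a difference quotient by at
    most e/8. Two such errors and the gap e/4 between \<open>D s\<close> and the infimum
    \<open>l\<close> add up to e/2, and multiplying by 2t gives e t.\<close>
  define \<delta> where "\<delta> = e / (8 * L)"
  have \<delta>: "\<delta> > 0" using e L by (simp add: \<delta>_def)
  have L\<delta>: "L * \<delta> = e / 8" using L by (simp add: \<delta>_def)
  have local: "\<exists>s>0. \<forall>u' t. norm u' = 1 \<longrightarrow> dist u u' < \<delta> \<longrightarrow> 0 < t \<longrightarrow> t < s \<longrightarrow>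
      k (2 *\<^sub>R t *\<^sub>R u') - 2 * k (t *\<^sub>R u') < e * t" if u: "norm u = 1" for u
  proof -
    define D where "D = (\<lambda>t. k (t *\<^sub>R u) / t)"
    \<comment> \<open>By monotonicity of the quotients, \<open>l\<close> is the directional
      derivative at \<open>z\<close> along \<open>u\<close>.\<close>
    define l where "l = Inf (D ` {0<..1})"
    have "- L \<le> D t" if "0 < t" "t \<le> 1" for t
      using kL[of "t *\<^sub>R u" 0] that u by (simp add: D_def k_def field_simps)
    then have bdd: "bdd_below (D ` {0<..1})"
      by (intro bdd_belowI2[of _ "-L"]) auto
    have l: "l \<le> D t" if "0 < t" "t \<le> 1" for t
      unfolding l_def using that by (intro cInf_lower bdd) auto
    have "\<exists>x\<in>D ` {0<..1}. x < l + e / 4"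
      using cInf_lessD[of "D ` {0<..1}" "l + e / 4"] e unfolding l_def by force
    then obtain s where s: "0 < s" "s \<le> 1" and Ds: "D s < l + e / 4" by auto
    have close: "\<bar>k (t *\<^sub>R u') / t - D t\<bar> \<le> e / 8"
      if u': "norm u' = 1" "dist u u' < \<delta>" and t: "0 < t" "t \<le> 1" for u' t
    proof -
      have "norm (t *\<^sub>R u' - t *\<^sub>R u) = t * dist u u'"
        using t by (simp add: dist_norm norm_minus_commute flip: scaleR_right_diff_distrib)
      then have "norm (t *\<^sub>R u' - t *\<^sub>R u) \<le> t * \<delta>" "norm (t *\<^sub>R u - t *\<^sub>R u') \<le> t * \<delta>"
        using u' t by (auto simp: norm_minus_commute)
      then have "L * norm (t *\<^sub>R u' - t *\<^sub>R u) \<le> t * (e / 8)" "L * norm (t *\<^sub>R u - t *\<^sub>R u') \<le> t * (e / 8)"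
        using L L\<delta> mult_left_mono[of _ "t * \<delta>" L] by (auto simp: algebra_simps)
      moreover have "norm (t *\<^sub>R u) \<le> 1" "norm (t *\<^sub>R u') \<le> 1" using u u' t by auto
      ultimately have "\<bar>k (t *\<^sub>R u') - k (t *\<^sub>R u)\<bar> \<le> t * (e / 8)"
        using kL[of "t *\<^sub>R u" "t *\<^sub>R u'"] kL[of "t *\<^sub>R u'" "t *\<^sub>R u"] by linarith
      moreover have "k (t *\<^sub>R u') / t - D t = (k (t *\<^sub>R u') - k (t *\<^sub>R u)) / t"
        by (simp add: D_def diff_divide_distrib)
      ultimately show ?thesis using t by (simp add: field_simps)
    qed
    have "k (2 *\<^sub>R t *\<^sub>R u') - 2 * k (t *\<^sub>R u') < e * t"
      if u': "norm u' = 1" "dist u u' < \<delta>" and t: "0 < t" "t < s / 2" for u' t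
    proof -
      have "k ((2 * t) *\<^sub>R u') / (2 * t) \<le> k (s *\<^sub>R u') / s" using t by (intro mono) auto
      moreover have "k (s *\<^sub>R u') / s \<le> D s + e / 8" using close[OF u', of s] s by linarith
      moreover have "k (t *\<^sub>R u') / t \<ge> D t - e / 8" using close[OF u', of t] s t by linarith
      moreover have "D t \<ge> l" using l s t by simp
      ultimately have "k ((2 * t) *\<^sub>R u') / (2 * t) - k (t *\<^sub>R u') / t < e / 2"
        using Ds by linarith
      then show ?thesis using t by (simp add: field_simps)
    qed
    then show ?thesis using s by (intro exI[of _ "s / 2"]) auto
  qed
  then have "\<forall>u. \<exists>s. norm u = 1 \<longrightarrow> s > 0 \<and> (\<forall>u' t. norm u' = 1 \<longrightarrow> dist u u' < \<delta> \<longrightarrow> 0 < t \<longrightarrow> t < s \<longrightarrow>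
      k (2 *\<^sub>R t *\<^sub>R u') - 2 * k (t *\<^sub>R u') < e * t)"
    by blast
  from choice[OF this] obtain s where s: "\<And>u. norm u = 1 \<Longrightarrow> s u > 0" and
    sk: "\<And>u u' t. norm u = 1 \<Longrightarrow> norm u' = 1 \<Longrightarrow> dist u u' < \<delta> \<Longrightarrow> 0 < t \<Longrightarrow> t < s u \<Longrightarrow>
      k (2 *\<^sub>R t *\<^sub>R u') - 2 * k (t *\<^sub>R u') < e * t"
    by blast
  have "compact (sphere (0::'a) 1)" by simp
  then obtain T where T: "finite T" "T \<subseteq> sphere (0::'a) 1" "sphere 0 1 \<subseteq> (\<Union>u\<in>T. ball u \<delta>)"
    by (rule compactE_image[where C = "sphere (0::'a) 1" and f = "\<lambda>u. ball u \<delta>"])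
      (use \<delta> in \<open>auto intro!: bexI centre_in_ball[THEN iffD2]\<close>)
  define r where "r = Min (insert 1 (s ` T))"
  have r: "r > 0" "\<And>u. u \<in> T \<Longrightarrow> r \<le> s u" using T s by (auto simp: r_def)
  show ?thesis
  proof (rule that[OF r(1)])
    fix x :: 'a assume x: "x \<noteq> 0" "norm x < r"
    define u' where "u' = (1 / norm x) *\<^sub>R x"
    have u': "norm u' = 1" using x by (simp add: u'_def)
    then obtain u where u: "u \<in> T" "dist u u' < \<delta>" using T(3) by fastforce
    have "norm u = 1" using u T by auto
    then have "k (2 *\<^sub>R norm x *\<^sub>R u') - 2 * k (norm x *\<^sub>R u') < e * norm x"
      using sk[of u u' "norm x"] u u' x r(2)[OF u(1)] by simp
    then show "h (z + 2 *\<^sub>R x) - 2 * h (z + x) + h z < e * norm x"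
      using x by (simp add: u'_def k_def)
  qed
qed

section \<open>Points of the set near a given point lie in the same component\<close>

lemma DC_infdist_accumulation:
  fixes M :: "'a::euclidean_space set"
  assumes M: "closed M" and DC: "DC_on UNIV (\<lambda>x. infdist x M)" and z: "z \<in> M"
  obtains r where "r > 0" "\<And>w. w \<in> M \<Longrightarrow> dist z w < r \<Longrightarrow> connected_component M z w"
proof -
  obtain g h where g: "convex_on UNIV g" and h: "convex_on UNIV h"
    and gh: "\<And>x. infdist x M = g x - h x"
    using DC unfolding DC_on_def by auto
  obtain r where r: "r > 0" and hr:
    "\<And>x. x \<noteq> 0 \<Longrightarrow> norm x < r \<Longrightarrow> h (z + 2 *\<^sub>R x) - 2 * h (z + x) + h z < 1 * norm x"
    using convex_on_UNIV_second_difference[OF h, of 1 z] by auto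
  have "connected_component M z w" if w: "w \<in> M" "dist z w < r" for w
  proof (rule ccontr)
    assume not_conn: "\<not> connected_component M z w"
    define K where "K = M \<inter> cball z (dist z w)"
    have K: "compact K" "w \<in> K" using M w by (auto simp: K_def closed_Int_compact)
    define C where "C = connected_component_set K w"
    have C: "C \<in> components K" using K by (auto simp: C_def components_def)
    have "z \<notin> C"
      using not_conn connected_component_of_subset[of K w z M]
      by (auto simp: C_def K_def connected_component_sym_eq)
    \<comment> \<open>A component of a compact set is the intersection of the clopen sets containing
      it, so some clopen \<open>T\<close> contains \<open>C\<close> and misses
      \<open>z\<close>.\<close>
    then obtain T where T: "C \<subseteq> T" "z \<notin> T" "openin (top_of_set K) T" "closedin (top_of_set K) T"
      using Sura_Bura_compact[OF K(1) C] by blast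
    have "w \<in> T" using T(1) K(2) by (auto simp: C_def)
    have TK: "T \<subseteq> K" using T(3) by (simp add: openin_imp_subset)
    have "compact T" using T(4) K(1) closedin_compact by blast
    moreover have "closedin (top_of_set K) (K - T)" using T(3) by (simp add: closedin_diff)
    then have cKT: "closed (K - T)"
      using K(1) closedin_compact compact_imp_closed by blast
    ultimately obtain p where p: "p \<in> T" and pmin: "\<And>y. y \<in> T \<Longrightarrow> dist z p \<le> dist z y"
      using distance_attains_inf[of T z] \<open>w \<in> T\<close> compact_imp_closed by (metis empty_iff)
    obtain \<delta> where \<delta>: "\<delta> > 0" "\<And>y. y \<in> K - T \<Longrightarrow> \<delta> \<le> dist p y"
      using separate_point_closed[OF cKT, of p] p by auto
    define a where "a = dist z p"
    have a: "a > 0" "a < r" using p T(2) pmin[OF \<open>w \<in> T\<close>] w by (auto simp: a_def)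
    have az: "a \<le> dist z w" using pmin[OF \<open>w \<in> T\<close>] by (simp add: a_def)
    have pM: "p \<in> M" using p TK by (auto simp: K_def)
    \<comment> \<open>So small that \<open>p\<close> is a nearest point of \<open>M\<close> to
      \<open>x\<close>, the point of the segment from \<open>p\<close> to \<open>z\<close> at
      distance \<open>t\<close> from \<open>p\<close>.\<close>
    define t where "t = min (\<delta> / 2) (a / 2)"
    have t: "t > 0" "t < a" "2 * t \<le> \<delta>" using \<delta> a by (auto simp: t_def)
    define q where "q = t / a"
    define x where "x = (1 - t / a) *\<^sub>R p + (t / a) *\<^sub>R z"
    have xp: "dist x p = t"
    proof -
      have "x - p = (t / a) *\<^sub>R (z - p)" by (simp add: x_def algebra_simps)
      then show ?thesis using t a by (simp add: dist_norm a_def)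
    qed
    have zx: "dist z x = a - t"
    proof -
      have "z - x = (1 - t / a) *\<^sub>R (z - p)" by (simp add: x_def algebra_simps)
      then have "dist z x = (1 - t / a) * a" using t a by (simp add: dist_norm a_def)
      then show ?thesis using a by (simp add: algebra_simps)
    qed
    have "t \<le> dist x y" if "y \<in> M" for y
    proof (cases "y \<in> K - T")
      case True
      then show ?thesis using \<delta>(2)[of y] t xp dist_triangle[of p y x] by (simp add: dist_commute)
    next
      case False
      \<comment> \<open>Points of \<open>T\<close> are no closer to \<open>z\<close> than
        \<open>p\<close>, and points of \<open>M\<close> outside \<open>K\<close> are farther from
        \<open>z\<close> than \<open>w\<close>.\<close>
      then have "a \<le> dist z y"
        using that pmin[of y] az by (cases "y \<in> T") (auto simp: a_def K_def)
      then show ?thesis using zx dist_triangle[of z y x] by simp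
    qed
    then have "t \<le> infdist x M"
      unfolding infdist_notempty[OF ex_in_conv[THEN iffD1, OF exI, OF z]]
      using z by (intro cINF_greatest) auto
    moreover have gx: "g x \<le> (1 - t / a) * g p + (t / a) * g z"
      using convex_onD[OF g, of "t / a" p z] t a by (simp add: x_def)
    \<comment> \<open>A lower bound for \<open>h x\<close> is needed because \<open>h\<close> is
      subtracted. It comes from convexity of \<open>h\<close> between \<open>x\<close> and the
      reflection \<open>2 *\<^sub>R p - z\<close> of \<open>z\<close> in \<open>p\<close>, with
      \<open>p\<close> in between.\<close>
    moreover have hx: "(1 + t / a) * h p \<le> h x + (t / a) * h (2 *\<^sub>R p - z)"
    proof -
      have 1: "1 - t / (a + t) = a / (a + t)" using a t by (simp add: field_simps)
      have "p = (1 - t / (a + t)) *\<^sub>R x + (t / (a + t)) *\<^sub>R (2 *\<^sub>R p - z)"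
      proof -
        have "a *\<^sub>R x = (a - t) *\<^sub>R p + t *\<^sub>R z"
          using a by (simp add: x_def scaleR_add_right right_diff_distrib)
        then have "a *\<^sub>R x + t *\<^sub>R (2 *\<^sub>R p - z) = (a + t) *\<^sub>R p"
          by (simp add: algebra_simps scaleR_2)
        then have "(1 / (a + t)) *\<^sub>R (a *\<^sub>R x + t *\<^sub>R (2 *\<^sub>R p - z)) = p" using a t by simp
        then show ?thesis unfolding 1 by (simp add: scaleR_add_right)
      qed
      then have "h p \<le> (1 - t / (a + t)) * h x + (t / (a + t)) * h (2 *\<^sub>R p - z)"
        using convex_onD[OF h, of "t / (a + t)" x "2 *\<^sub>R p - z"] t a by simp
      also have "\<dots> = (a * h x + t * h (2 *\<^sub>R p - z)) / (a + t)"
        unfolding 1 by (simp add: add_divide_distrib)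
      finally have "(a + t) * h p \<le> a * h x + t * h (2 *\<^sub>R p - z)"
        using a t by (simp add: pos_le_divide_eq mult.commute)
      then have "((a + t) * h p) / a \<le> (a * h x + t * h (2 *\<^sub>R p - z)) / a"
        using a by (intro divide_right_mono) auto
      then show ?thesis using a by (simp add: add_divide_distrib distrib_right)
    qed
    moreover have "g z = h z" "g p = h p" using gh[of z] gh[of p] z pM by auto
    \<comment> \<open>Replacing \<open>g\<close> by \<open>h\<close> at \<open>z\<close> and
      \<open>p\<close> leaves exactly t/a times the second difference of \<open>h\<close> with step
      \<open>p - z\<close>.\<close>
    ultimately have "t \<le> (t / a) * (h (2 *\<^sub>R p - z) - 2 * h p + h z)"
      using gh[of x] unfolding q_def[symmetric] by (simp add: algebra_simps)
    then have "t * a \<le> t * (h (2 *\<^sub>R p - z) - 2 * h p + h z)"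
      using a by (simp add: field_simps)
    then have "a \<le> h (2 *\<^sub>R p - z) - 2 * h p + h z"
      using t by simp
    moreover have "h (z + 2 *\<^sub>R (p - z)) - 2 * h (z + (p - z)) + h z < norm (p - z)"
      using hr[of "p - z"] a by (auto simp: a_def dist_norm norm_minus_commute)
    ultimately show False
      by (simp add: a_def dist_norm norm_minus_commute algebra_simps scaleR_2)
  qed
  then show ?thesis using that r by blast
qed

section \<open>Closure properties and basic examples of convex functions\<close>

lemma convex_on_eqI:
  assumes "convex_on S f" "\<And>x. x \<in> S \<Longrightarrow> g x = f x"
  shows "convex_on S g"
  using assms unfolding convex_on_def by (metis convexD)

lemma convex_on_max:
  assumes "convex_on S f" "convex_on S g"
  shows "convex_on S (\<lambda>x. max (f x) (g x))"
proof (rule convex_onI)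
  fix t :: real and x y assume t: "0 < t" "t < 1" and xy: "x \<in> S" "y \<in> S"
  have "(1 - t) * f x + t * f y \<le> (1 - t) * max (f x) (g x) + t * max (f y) (g y)"
    and "(1 - t) * g x + t * g y \<le> (1 - t) * max (f x) (g x) + t * max (f y) (g y)"
    using t by (auto intro!: add_mono mult_left_mono)
  then show "max (f ((1 - t) *\<^sub>R x + t *\<^sub>R y)) (g ((1 - t) *\<^sub>R x + t *\<^sub>R y))
      \<le> (1 - t) * max (f x) (g x) + t * max (f y) (g y)"
    using convex_onD[OF assms(1), of t x y] convex_onD[OF assms(2), of t x y] t xy by auto
qed (use assms in \<open>auto dest: convex_on_imp_convex\<close>)

lemma convex_on_SUP:
  assumes "convex S" "I \<noteq> {}" "\<And>i. i \<in> I \<Longrightarrow> convex_on S (f i)"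
    and bdd: "\<And>x. x \<in> S \<Longrightarrow> bdd_above ((\<lambda>i. f i x) ` I)"
  shows "convex_on S (\<lambda>x. SUP i\<in>I. f i x :: real)"
proof (rule convex_onI)
  fix t :: real and x y assume t: "0 < t" "t < 1" and xy: "x \<in> S" "y \<in> S"
  show "(SUP i\<in>I. f i ((1 - t) *\<^sub>R x + t *\<^sub>R y)) \<le> (1 - t) * (SUP i\<in>I. f i x) + t * (SUP i\<in>I. f i y)"
  proof (rule cSUP_least)
    fix i assume i: "i \<in> I"
    have "f i ((1 - t) *\<^sub>R x + t *\<^sub>R y) \<le> (1 - t) * f i x + t * f i y"
      using convex_onD[OF assms(3)[OF i], of t x y] t xy by simp
    also have "\<dots> \<le> (1 - t) * (SUP i\<in>I. f i x) + t * (SUP i\<in>I. f i y)"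
      using t xy i bdd by (intro add_mono mult_left_mono cSUP_upper) auto
    finally show "f i ((1 - t) *\<^sub>R x + t *\<^sub>R y) \<le> \<dots>" .
  qed fact
qed fact

lemma convex_on_sum_fun:
  assumes "convex S" "\<And>i. i \<in> I \<Longrightarrow> convex_on S (f i)"
  shows "convex_on S (\<lambda>x. \<Sum>i\<in>I. f i x :: real)"
  using assms(2)
proof (induction I rule: infinite_finite_induct)
  case (insert i I)
  then show ?case by (simp add: convex_on_add)
qed (auto simp: convex_on_const assms(1))

lemma convex_on_norm_power2: "convex_on UNIV (\<lambda>x::'a::real_inner. (norm x)\<^sup>2)"
proof (rule convex_onI)
  fix t :: real and x y :: 'a assume t: "0 < t" "t < 1"
  have "(1 - t) * (norm x)\<^sup>2 + t * (norm y)\<^sup>2 - (norm ((1 - t) *\<^sub>R x + t *\<^sub>R y))\<^sup>2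
      = t * (1 - t) * (norm (x - y))\<^sup>2"
    unfolding power2_norm_eq_inner
    by (simp add: inner_add_left inner_add_right inner_diff_left inner_diff_right inner_commute algebra_simps)
  moreover have "\<dots> \<ge> 0" using t by simp
  ultimately show "(norm ((1 - t) *\<^sub>R x + t *\<^sub>R y))\<^sup>2 \<le> (1 - t) * (norm x)\<^sup>2 + t * (norm y)\<^sup>2"
    by linarith
qed simp

lemma convex_on_inner_left: "convex_on UNIV (\<lambda>x::'a::real_inner. x \<bullet> a)"
  by (rule convex_onI) (auto simp: inner_add_left)

section \<open>Distance functions away from their set\<close>

text \<open>For \<open>s > 0\<close>, \<open>s\<close> is the minimum of \<open>(s\<^sup>2/c + c)/2\<close> over \<open>c > 0\<close>. Restricting to \<open>c \<ge> r\<close> in the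
  resulting formula for the distance function leaves it unchanged where it is at least \<open>r\<close>, and
  makes \<open>\<parallel>x\<parallel>\<^sup>2/(2r)\<close> minus it a supremum of convex functions.\<close>

lemma DC_infdist_away:
  fixes A :: "'a::euclidean_space set"
  assumes A: "closed A" "A \<noteq> {}" and r: "r > 0"
  obtains F where "DC_on UNIV F" "\<And>x. infdist x A \<ge> r \<Longrightarrow> F x = infdist x A"
proof -
  define q where "q = (\<lambda>(a, c) x::'a. (norm x)\<^sup>2 / (2 * r) - ((norm (x - a))\<^sup>2 / c + c) / 2)"
  define I where "I = A \<times> {r..}"
  define H where "H = (\<lambda>x. SUP i\<in>I. q i x)"
  have I: "I \<noteq> {}" using A by (auto simp: I_def)
  have conv: "convex_on UNIV (q i)" if i: "i \<in> I" for i
  proof -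
    obtain a c where ac: "i = (a, c)" "c \<ge> r" using i by (auto simp: I_def)
    have "c > 0" using ac r by simp
    \<comment> \<open>After expanding the square, the coefficient of the quadratic term is
      nonnegative because \<open>c\<close> is at least \<open>r\<close>; the rest is affine in
      \<open>x\<close>.\<close>
    have eq: "q i x = (1 / (2 * r) - 1 / (2 * c)) * (norm x)\<^sup>2 + ((1 / c) * (x \<bullet> a) + (- (norm a)\<^sup>2 / (2 * c) - c / 2))" for x
      using \<open>c > 0\<close> r unfolding ac q_def power2_norm_eq_inner
      by (simp add: inner_diff_left inner_diff_right inner_commute field_simps)
    have "convex_on UNIV (\<lambda>x::'a. (1 / (2 * r) - 1 / (2 * c)) * (norm x)\<^sup>2 + ((1 / c) * (x \<bullet> a) + (- (norm a)\<^sup>2 / (2 * c) - c / 2)))"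
      using ac r \<open>c > 0\<close>
      by (intro convex_on_add convex_on_cmul convex_on_norm_power2 convex_on_inner_left)
        (auto simp: convex_on_const frac_le)
    then show ?thesis by (rule convex_on_eqI) (simp add: eq)
  qed
  have ub: "q i x \<le> (norm x)\<^sup>2 / (2 * r)" if "i \<in> I" for i x
    using that r by (auto simp: q_def I_def)
  have bdd: "bdd_above ((\<lambda>i. q i x) ` I)" for x
    using ub by (intro bdd_aboveI2)
  have "convex_on UNIV H"
    unfolding H_def using conv bdd I by (intro convex_on_SUP) auto
  moreover have "convex_on UNIV (\<lambda>x::'a. (1 / (2 * r)) * (norm x)\<^sup>2)"
    using r by (intro convex_on_cmul convex_on_norm_power2) auto
  ultimately have DC: "DC_on UNIV (\<lambda>x::'a. (1 / (2 * r)) * (norm x)\<^sup>2 - H x)"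
    unfolding DC_on_def by blast
  have "(1 / (2 * r)) * (norm x)\<^sup>2 - H x = infdist x A" if x: "infdist x A \<ge> r" for x
  proof -
    obtain a where a: "a \<in> A" "infdist x A = dist x a"
      using infdist_attains_inf[OF A] by blast
    have "q i x \<le> (norm x)\<^sup>2 / (2 * r) - infdist x A" if i: "i \<in> I" for i
    proof -
      obtain b c where bc: "i = (b, c)" "c \<ge> r" "b \<in> A" using i by (auto simp: I_def)
      have "c > 0" using bc r by simp
      have "0 \<le> (norm (x - b) - c)\<^sup>2" by simp
      then have "2 * norm (x - b) * c \<le> (norm (x - b))\<^sup>2 + c\<^sup>2" by (simp add: power2_diff)
      then have "norm (x - b) \<le> ((norm (x - b))\<^sup>2 / c + c) / 2"
        using \<open>c > 0\<close> by (simp add: field_simps power2_eq_square)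
      moreover have "infdist x A \<le> norm (x - b)"
        using infdist_le[OF bc(3), of x] by (simp add: dist_norm)
      ultimately show ?thesis by (simp add: q_def bc)
    qed
    then have "H x \<le> (norm x)\<^sup>2 / (2 * r) - infdist x A"
      unfolding H_def using I by (intro cSUP_least) auto
    \<comment> \<open>The bound is attained at a nearest point \<open>a\<close> with
      \<open>c = dist x a\<close>, which is admissible because the distance is at least
      \<open>r\<close>.\<close>
    moreover have "q (a, dist x a) x \<le> H x"
      unfolding H_def using a x bdd by (intro cSUP_upper) (auto simp: I_def)
    moreover have "q (a, dist x a) x = (norm x)\<^sup>2 / (2 * r) - infdist x A"
      using a x r by (simp add: q_def dist_norm power2_eq_square)
    ultimately show ?thesis by simp
  qed
  with DC show ?thesis by (rule that)
qed

section \<open>Globalization: local convexity and Hartman's theorem\<close>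

text \<open>A maximum principle: if convexity fails on a segment, the excess of \<open>f\<close>
  over the chord has a positive maximum. At its leftmost maximizer, which is interior, local
  midpoint convexity is violated.\<close>

lemma locally_convex_imp_convex_on:
  fixes f :: "'a::real_normed_vector \<Rightarrow> real"
  assumes cont: "continuous_on UNIV f" and loc: "\<And>x. \<exists>e>0. convex_on (ball x e) f"
  shows "convex_on UNIV f"
proof (rule convex_onI)
  fix t :: real and x y :: 'a assume t: "0 < t" "t < 1"
  define p where "p = (\<lambda>s::real. (1 - s) *\<^sub>R x + s *\<^sub>R y)"
  define \<psi> where "\<psi> = (\<lambda>s. f (p s) - ((1 - s) * f x + s * f y))"
  have cont\<psi>: "continuous_on {0..1} \<psi>"
    unfolding \<psi>_def p_def
    by (intro continuous_intros continuous_on_compose2[OF cont]) auto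
  show "f ((1 - t) *\<^sub>R x + t *\<^sub>R y) \<le> (1 - t) * f x + t * f y"
  proof (rule ccontr)
    assume "\<not> ?thesis"
    then have "\<psi> t > 0" by (simp add: \<psi>_def p_def)
    obtain m where m: "m \<in> {0..1}" "\<And>s. s \<in> {0..1} \<Longrightarrow> \<psi> s \<le> \<psi> m"
      using continuous_attains_sup[of "{0..1::real}" \<psi>] cont\<psi> by auto
    have mpos: "\<psi> m > 0" using m(2)[of t] t \<open>\<psi> t > 0\<close> by simp
    define S where "S = {s \<in> {0..1}. \<psi> s = \<psi> m}"
    have "closed S"
      using continuous_closed_preimage_constant[OF cont\<psi>, of "\<psi> m"] by (simp add: S_def)
    moreover have "S \<subseteq> {0..1}" by (auto simp: S_def)
    ultimately have "compact S"
      using bounded_subset[OF bounded_closed_interval] by (simp add: compact_eq_bounded_closed)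
    \<comment> \<open>Taking the leftmost maximizer makes the excess strictly smaller just to the
      left of \<open>s\<close>.\<close>
    then obtain s where s: "s \<in> S" "\<And>u. u \<in> S \<Longrightarrow> s \<le> u"
      using compact_attains_inf[of S] m by (auto simp: S_def)
    have "\<psi> 0 = 0" "\<psi> 1 = 0" by (auto simp: \<psi>_def p_def)
    then have s01: "0 < s" "s < 1"
      using s(1) mpos by (auto simp: S_def less_le)
    obtain e where e: "e > 0" "convex_on (ball (p s) e) f" using loc by blast
    \<comment> \<open>The summand 1 keeps \<open>n\<close> positive even if
      \<open>x = y\<close>.\<close>
    define n where "n = norm (y - x) + 1"
    have n: "n > 0" by (simp add: n_def add_nonneg_pos)
    define \<eta> where "\<eta> = min (min s (1 - s)) (e / (2 * n))"
    have \<eta>: "\<eta> > 0" "\<eta> \<le> s" "\<eta> \<le> 1 - s" using s01 e n by (auto simp: \<eta>_def)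
    have "\<eta> * n \<le> e / (2 * n) * n"
      using n by (intro mult_right_mono) (auto simp: \<eta>_def)
    then have "\<eta> * n < e" using n e by simp
    then have "\<eta> * norm (y - x) < e" using \<eta> by (simp add: n_def distrib_left)
    moreover have pm: "p (s - \<eta>) = p s - \<eta> *\<^sub>R (y - x)" "p (s + \<eta>) = p s + \<eta> *\<^sub>R (y - x)"
      by (auto simp: p_def algebra_simps)
    ultimately have in_ball: "p (s - \<eta>) \<in> ball (p s) e" "p (s + \<eta>) \<in> ball (p s) e"
      using \<eta> by (auto simp: dist_norm)
    have "p s = (1 - 1/2) *\<^sub>R p (s - \<eta>) + (1/2) *\<^sub>R p (s + \<eta>)"
    proof -
      have "p (s - \<eta>) + p (s + \<eta>) = p s + p s" unfolding pm by simp
      then have "(1/2) *\<^sub>R (p (s - \<eta>) + p (s + \<eta>)) = p s" by (simp only: scaleR_half_double)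
      then show ?thesis by (simp add: scaleR_add_right)
    qed
    then have "f (p s) \<le> (1 - 1/2) * f (p (s - \<eta>)) + (1/2) * f (p (s + \<eta>))"
      using convex_onD[OF e(2), of "1/2"] in_ball by simp
    \<comment> \<open>The chord is affine in the parameter, so subtracting it preserves the midpoint
      inequality.\<close>
    then have "2 * \<psi> s \<le> \<psi> (s - \<eta>) + \<psi> (s + \<eta>)"
      by (simp add: \<psi>_def algebra_simps)
    moreover have "\<psi> (s + \<eta>) \<le> \<psi> m" using \<eta> by (intro m) auto
    moreover have "\<psi> (s - \<eta>) \<le> \<psi> m" "\<psi> (s - \<eta>) \<noteq> \<psi> m"
      using \<eta> s(2)[of "s - \<eta>"] s01 by (auto simp: S_def intro!: m(2))
    ultimately show False using s(1) by (simp add: S_def)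
  qed
qed simp

text \<open>Finitely many balls on which \<open>f + h z\<close> is convex cover the annulus, and the
  sum \<psi> of these \<open>h z\<close> corrects \<open>f\<close> on all of them. Adding a steep
  cone and taking the maximum with 0 removes the correction on the inner ball while keeping it near
  the annulus.\<close>

lemma DC_annulus:
  fixes f :: "'a::euclidean_space \<Rightarrow> real"
  assumes loc: "\<And>z. \<exists>e>0. \<exists>g h. convex_on UNIV g \<and> convex_on UNIV h \<and> (\<forall>x\<in>ball z e. f x = g x - h x)"
  shows "\<exists>\<phi>. convex_on UNIV \<phi> \<and> (\<forall>x. norm x \<le> R - 1 \<longrightarrow> \<phi> x = 0) \<and>
    (\<forall>x. norm x \<in> {R..R+1} \<longrightarrow> (\<exists>e>0. convex_on (ball x e) (\<lambda>y. f y + \<phi> y)))"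
proof -
  obtain e h where e: "\<And>z. e z > 0" and h: "\<And>z. convex_on UNIV (h z)"
    and fh: "\<And>z. convex_on (ball z (e z)) (\<lambda>x. f x + h z x)"
  proof -
    have "\<exists>p. fst p > 0 \<and> convex_on UNIV (snd p) \<and> convex_on (ball z (fst p)) (\<lambda>x. f x + snd p x)" for z
    proof -
      obtain e g h where e: "e > 0" and g: "convex_on UNIV g" and h: "convex_on UNIV h"
        and eq: "\<forall>x\<in>ball z e. f x = g x - h x"
        using loc by blast
      have "convex_on (ball z e) g" using g by (rule convex_on_subset) auto
      then have "convex_on (ball z e) (\<lambda>x. f x + h x)"
        by (rule convex_on_eqI) (use eq in auto)
      then show ?thesis using e h by (intro exI[of _ "(e, h)"]) simp
    qed
    then have "\<forall>z. \<exists>p. fst p > 0 \<and> convex_on UNIV (snd p) \<and> convex_on (ball z (fst p)) (\<lambda>x. f x + snd p x)"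
      by blast
    from choice[OF this] obtain p where "\<forall>z. fst (p z) > 0 \<and> convex_on UNIV (snd (p z)) \<and>
        convex_on (ball z (fst (p z))) (\<lambda>x. f x + snd (p z) x)" by blast
    then show ?thesis by (intro that[of "\<lambda>z. fst (p z)" "\<lambda>z. snd (p z)"]) auto
  qed
  define K where "K = cball (0::'a) (R + 1) - ball 0 R"
  have "compact K" unfolding K_def by (intro compact_diff) auto
  then obtain T where T: "finite T" "T \<subseteq> K" "K \<subseteq> (\<Union>z\<in>T. ball z (e z))"
    by (rule compactE_image[where C = K and f = "\<lambda>z. ball z (e z)"])
      (use e in \<open>auto intro!: bexI centre_in_ball[THEN iffD2]\<close>)
  define \<psi> where "\<psi> = (\<lambda>x. \<Sum>z\<in>T. h z x)"
  have \<psi>: "convex_on UNIV \<psi>" unfolding \<psi>_def by (intro convex_on_sum_fun h) simp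
  have "compact (\<psi> ` cball 0 (R + 2))"
    by (intro compact_continuous_image continuous_on_subset[OF convex_on_continuous[OF open_UNIV \<psi>]]) auto
  then obtain B where "B > 0" and B: "\<And>x. norm x \<le> R + 2 \<Longrightarrow> \<bar>\<psi> x\<bar> \<le> B"
    using compact_imp_bounded[of "\<psi> ` cball 0 (R + 2)"] by (auto simp: bounded_pos)
  \<comment> \<open>The cone term is at most -B where \<open>norm x\<close> is at most R - 1 and at
    least B where it is at least R - 1/2. As \<psi> lies between -B and B up to radius R + 2, this
    fixes the sign of \<theta> in both regions.\<close>
  define \<theta> where "\<theta> = (\<lambda>x. \<psi> x + (4 * B * norm x + (- B - 4 * B * (R - 1))))"
  define \<phi> where "\<phi> = (\<lambda>x. max 0 (\<theta> x))"
  have affine: "convex_on UNIV (\<lambda>x::'a. 4 * B * norm x + (- B - 4 * B * (R - 1)))"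
    using \<open>B > 0\<close> convex_on_dist[of UNIV "0::'a"]
    by (intro convex_on_add convex_on_cmul) (auto simp: convex_on_const)
  show ?thesis
  proof (intro exI[of _ \<phi>] conjI allI impI)
    show "convex_on UNIV \<phi>"
      unfolding \<phi>_def \<theta>_def by (intro convex_on_max convex_on_add \<psi> affine) (simp add: convex_on_const)
    show "\<phi> x = 0" if x: "norm x \<le> R - 1" for x
    proof -
      have "4 * B * norm x \<le> 4 * B * (R - 1)" using x \<open>B > 0\<close> by (intro mult_left_mono) auto
      then show ?thesis using B[of x] x by (auto simp: \<phi>_def \<theta>_def)
    qed
    show "\<exists>\<delta>>0. convex_on (ball x \<delta>) (\<lambda>y. f y + \<phi> y)" if x: "norm x \<in> {R..R+1}" for x
    proof -
      have "x \<in> K" using x by (auto simp: K_def)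
      then obtain z where z: "z \<in> T" "x \<in> ball z (e z)" using T(3) by blast
      obtain d where d: "d > 0" "ball x d \<subseteq> ball z (e z)"
        using openE[OF open_ball z(2)] .
      define \<delta> where "\<delta> = min d (1/2)"
      have \<delta>: "\<delta> > 0" "ball x \<delta> \<subseteq> ball z (e z)" using d by (auto simp: \<delta>_def)
      \<comment> \<open>Only the summand \<open>h z\<close> belonging to this ball is spent on
        making \<open>f\<close> convex; the other summands and the cone are convex
        themselves.\<close>
      have "convex_on (ball x \<delta>) (\<lambda>y. (f y + h z y) + ((\<Sum>z\<in>T - {z}. h z y) + (4 * B * norm y + (- B - 4 * B * (R - 1)))))"
      proof (rule convex_on_add)
        show "convex_on (ball x \<delta>) (\<lambda>y. f y + h z y)"
          by (rule convex_on_subset[OF fh \<delta>(2) convex_ball])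
        have "convex_on UNIV (\<lambda>y. (\<Sum>z\<in>T - {z}. h z y) + (4 * B * norm y + (- B - 4 * B * (R - 1))))"
          by (intro convex_on_add convex_on_sum_fun h affine convex_UNIV)
        then show "convex_on (ball x \<delta>) (\<lambda>y. (\<Sum>z\<in>T - {z}. h z y) + (4 * B * norm y + (- B - 4 * B * (R - 1))))"
          by (rule convex_on_subset[OF _ subset_UNIV convex_ball])
      qed
      moreover have "f y + \<phi> y = (f y + h z y) + ((\<Sum>z\<in>T - {z}. h z y) + (4 * B * norm y + (- B - 4 * B * (R - 1))))"
        if y: "y \<in> ball x \<delta>" for y
      proof -
        have "norm (x - y) < 1/2" using y by (auto simp: \<delta>_def dist_norm)
        then have ny: "norm y \<ge> R - 1/2" "norm y \<le> R + 2"
          using x norm_triangle_ineq2[of x y] norm_triangle_ineq2[of y x] by (auto simp: norm_minus_commute)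
        have "4 * B * norm y \<ge> 4 * B * (R - 1/2)" using ny \<open>B > 0\<close> by (intro mult_left_mono) auto
        then have "\<theta> y \<ge> 0" using B[OF ny(2)] by (simp add: \<theta>_def algebra_simps)
        then have "\<phi> y = \<theta> y" by (simp add: \<phi>_def)
        moreover have "\<psi> y = h z y + (\<Sum>z\<in>T - {z}. h z y)"
          unfolding \<psi>_def using T(1) z(1) by (rule sum.remove)
        ultimately show ?thesis by (simp add: \<theta>_def)
      qed
      ultimately have "convex_on (ball x \<delta>) (\<lambda>y. f y + \<phi> y)" by (rule convex_on_eqI)
      then show ?thesis using \<delta> by blast
    qed
  qed
qed

text \<open>Hartman's theorem. The convex functions controlling \<open>f\<close> on the annuli \<open>n \<le> \<parallel>x\<parallel> \<le> n + 1\<close> vanish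
  near the origin, so they can be summed over all \<open>n\<close>.\<close>

theorem locally_DC_imp_DC:
  fixes f :: "'a::euclidean_space \<Rightarrow> real"
  assumes loc: "\<And>z. \<exists>U F. open U \<and> z \<in> U \<and> DC_on UNIV F \<and> (\<forall>x\<in>U. f x = F x)"
  shows "DC_on UNIV f"
proof -
  have loc': "\<exists>e>0. \<exists>g h. convex_on UNIV g \<and> convex_on UNIV h \<and> (\<forall>x\<in>ball z e. f x = g x - h x)" for z
  proof -
    obtain U F where U: "open U" "z \<in> U" and F: "DC_on UNIV F" "\<And>x. x \<in> U \<Longrightarrow> f x = F x"
      using loc[of z] by blast
    obtain g h where gh: "convex_on UNIV g" "convex_on UNIV h" "\<And>x. F x = g x - h x"
      using F(1) unfolding DC_on_def by blast
    obtain e where "e > 0" "ball z e \<subseteq> U" using openE[OF U] .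
    moreover from this have "\<forall>x\<in>ball z e. f x = g x - h x"
      using F(2) gh(3) by (simp add: subset_iff)
    ultimately show ?thesis using gh(1,2) by blast
  qed
  have "\<forall>n. \<exists>\<phi>. convex_on UNIV \<phi> \<and> (\<forall>x. norm x \<le> real n - 1 \<longrightarrow> \<phi> x = 0) \<and>
      (\<forall>x. norm x \<in> {real n..real n + 1} \<longrightarrow> (\<exists>e>0. convex_on (ball x e) (\<lambda>y. f y + \<phi> y)))"
    using DC_annulus[OF loc'] by (intro allI)
  from choice[OF this] obtain \<phi> where \<phi>: "\<And>n. convex_on UNIV (\<phi> n)"
    and \<phi>0: "\<And>n x. norm x \<le> real n - 1 \<Longrightarrow> \<phi> n x = 0"
    and f\<phi>: "\<And>n x. norm x \<in> {real n..real n + 1} \<Longrightarrow> \<exists>e>0. convex_on (ball x e) (\<lambda>y. f y + \<phi> n y)"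
    by blast
  define H where "H = (\<lambda>x. \<Sum>n. \<phi> n x)"
  \<comment> \<open>For \<open>norm x\<close> at most N, every term with index at least N + 1
    vanishes, so the series is a finite sum on each ball.\<close>
  have H: "H x = (\<Sum>n<Suc N. \<phi> n x)" if "norm x \<le> real N" for x N
    unfolding H_def using that by (intro suminf_finite) (auto intro!: \<phi>0)
  have convS: "convex_on UNIV (\<lambda>x. \<Sum>n\<in>I. \<phi> n x)" for I
    by (intro convex_on_sum_fun \<phi>) simp
  have convH: "convex_on UNIV H"
  proof (rule convex_onI)
    fix t :: real and x y :: 'a assume t: "0 < t" "t < 1"
    obtain N :: nat where N: "norm x \<le> real N" "norm y \<le> real N"
      using real_arch_simple[of "max (norm x) (norm y)"] by auto
    then have "(1 - t) *\<^sub>R x + t *\<^sub>R y \<in> cball 0 (real N)"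
      using convexD[OF convex_cball[of "0::'a" "real N"], of x y "1 - t" t] t by auto
    then have "norm ((1 - t) *\<^sub>R x + t *\<^sub>R y) \<le> real N" by simp
    from H[OF this] H[OF N(1)] H[OF N(2)]
    show "H ((1 - t) *\<^sub>R x + t *\<^sub>R y) \<le> (1 - t) * H x + t * H y"
      using convex_onD[OF convS, of t x y "{..<Suc N}"] t by (simp only:) simp
  qed simp
  have "isCont f x" for x
  proof -
    obtain e g h where e: "e > 0" and gh: "convex_on UNIV g" "convex_on UNIV h"
      and eq: "\<And>y. y \<in> ball x e \<Longrightarrow> f y = g y - h y"
      using loc' by blast
    have "continuous_on (ball x e) (\<lambda>y. g y - h y)"
      by (intro continuous_on_diff continuous_on_subset[OF convex_on_continuous[OF open_UNIV gh(1)]]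
          continuous_on_subset[OF convex_on_continuous[OF open_UNIV gh(2)]]) auto
    then have "continuous_on (ball x e) f"
      by (rule continuous_on_eq) (simp add: eq)
    then show ?thesis using e by (simp add: continuous_on_eq_continuous_at)
  qed
  then have "continuous_on UNIV f" by (simp add: continuous_on_eq_continuous_at)
  then have cont: "continuous_on UNIV (\<lambda>x. f x + H x)"
    by (rule continuous_on_add[OF _ convex_on_continuous[OF open_UNIV convH]])
  have "convex_on UNIV (\<lambda>x. f x + H x)"
  proof (rule locally_convex_imp_convex_on[OF cont])
    fix x :: 'a
    define n where "n = nat \<lfloor>norm x\<rfloor>"
    have n: "norm x \<in> {real n..real n + 1}"
      unfolding n_def using norm_ge_zero[of x] by auto
    then obtain d where d: "d > 0" "convex_on (ball x d) (\<lambda>y. f y + \<phi> n y)" using f\<phi> by blast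
    define e where "e = min d 1"
    \<comment> \<open>The ball has radius at most 1, so it stays within norm n + 2, where
      \<open>H\<close> is the sum up to index n + 2. The term \<phi> n is split off to make
      \<open>f\<close> convex.\<close>
    have "convex_on (ball x e) (\<lambda>y. (f y + \<phi> n y) + (\<Sum>m\<in>{..<Suc (n + 2)} - {n}. \<phi> m y))"
      by (rule convex_on_add[OF convex_on_subset[OF d(2)] convex_on_subset[OF convS]])
        (auto simp: e_def)
    moreover have "f y + H y = (f y + \<phi> n y) + (\<Sum>m\<in>{..<Suc (n + 2)} - {n}. \<phi> m y)" if "y \<in> ball x e" for y
    proof -
      have "norm (x - y) < 1" using that by (auto simp: e_def dist_norm)
      then have "norm y \<le> real (n + 2)"
        using n norm_triangle_ineq2[of y x] by (auto simp: norm_minus_commute)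
      then have "H y = (\<Sum>m<Suc (n + 2). \<phi> m y)" by (rule H)
      also have "\<dots> = \<phi> n y + (\<Sum>m\<in>{..<Suc (n + 2)} - {n}. \<phi> m y)" by (rule sum.remove) auto
      finally show ?thesis by simp
    qed
    ultimately have "convex_on (ball x e) (\<lambda>y. f y + H y)" by (rule convex_on_eqI)
    then show "\<exists>e>0. convex_on (ball x e) (\<lambda>y. f y + H y)" using d by (intro exI[of _ e]) (auto simp: e_def)
  qed
  then show ?thesis using convH unfolding DC_on_def by (intro exI[of _ "\<lambda>x. f x + H x"] exI[of _ H]) auto
qed

section \<open>Distance functions of a set and of its components\<close>

text \<open>By Hartman's theorem a local check suffices, and \<open>DC_infdist_away\<close> settles
  every point outside \<open>A\<close>.\<close>

lemma DC_infdist_locally: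
  fixes A :: "'a::euclidean_space set"
  assumes A: "closed A" "A \<noteq> {}"
    and loc: "\<And>z. z \<in> A \<Longrightarrow> \<exists>e>0. \<exists>F. DC_on UNIV F \<and> (\<forall>x\<in>ball z e. infdist x A = F x)"
  shows "DC_on UNIV (\<lambda>x. infdist x A)"
proof (rule locally_DC_imp_DC)
  fix z
  show "\<exists>U F. open U \<and> z \<in> U \<and> DC_on UNIV F \<and> (\<forall>x\<in>U. infdist x A = F x)"
  proof (cases "z \<in> A")
    case True
    then show ?thesis using loc by (meson centre_in_ball open_ball)
  next
    case False
    define r where "r = infdist z A / 2"
    have r: "r > 0" using infdist_pos_not_in_closed[OF A False] by (simp add: r_def)
    obtain F where F: "DC_on UNIV F" "\<And>x. infdist x A \<ge> r \<Longrightarrow> F x = infdist x A"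
      using DC_infdist_away[OF A r] by blast
    have "infdist x A \<ge> r" if "x \<in> ball z r" for x
      using that infdist_triangle[of z A x] by (simp add: r_def)
    then show ?thesis using F r by (intro exI[of _ "ball z r"] exI[of _ F]) auto
  qed
qed

text \<open>If \<open>U\<close> meets no component but \<open>C\<close> and contains the ball of
  radius \<open>d\<close> about \<open>z\<close>, then a nearest point of \<open>M\<close> to some
  \<open>x\<close> within d/2 of \<open>z\<close> lies within \<open>d\<close> of \<open>z\<close>,
  hence in \<open>C\<close>.\<close>

lemma infdist_component_eq:
  fixes M :: "'a::euclidean_space set"
  assumes M: "closed M" and disc: "discrete_system (components M)"
    and C: "C \<in> components M" and z: "z \<in> C"
  obtains e where "e > 0" "\<And>x. x \<in> ball z e \<Longrightarrow> infdist x M = infdist x C"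
proof -
  obtain U where U: "open U" "z \<in> U" and
    uniq: "\<And>A B. A \<in> components M \<Longrightarrow> B \<in> components M \<Longrightarrow> U \<inter> A \<noteq> {} \<Longrightarrow> U \<inter> B \<noteq> {} \<Longrightarrow> A = B"
    using disc unfolding discrete_system_def by metis
  obtain d where d: "d > 0" "ball z d \<subseteq> U" using U open_contains_ball by blast
  have CM: "C \<subseteq> M" using C by (rule in_components_subset)
  have "infdist x M = infdist x C" if x: "x \<in> ball z (d / 2)" for x
  proof (rule antisym)
    show "infdist x M \<le> infdist x C" using CM z by (intro infdist_mono) auto
    obtain p where p: "p \<in> M" "infdist x M = dist x p"
      using infdist_attains_inf[OF M] CM z by blast
    have "dist x p \<le> dist x z" using infdist_le[of z M x] p CM z by auto
    then have "dist z p < d" using x dist_triangle[of z p x] by (simp add: dist_commute)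
    then have "p \<in> U" using d by auto
    moreover obtain B where B: "B \<in> components M" "p \<in> B"
      using p Union_components[of M] by blast
    ultimately have "B = C" using uniq[OF B(1) C] U z by blast
    then show "infdist x C \<le> infdist x M" using infdist_le[of p C x] B p by simp
  qed
  then show ?thesis using d by (intro that[of "d / 2"]) auto
qed

text \<open>Around a point of \<open>M\<close>, \<open>DC_infdist_accumulation\<close> gives a ball
  meeting only that point's component; around any other point, the complement of \<open>M\<close>
  serves.\<close>

lemma DC_infdist_imp_discrete_components:
  fixes M :: "'a::euclidean_space set"
  assumes M: "closed M" and DC: "DC_on UNIV (\<lambda>x. infdist x M)"
  shows "discrete_system (components M)"
  unfolding discrete_system_def
proof
  fix z
  show "\<exists>U. open U \<and> z \<in> U \<and> (\<forall>A\<in>components M. \<forall>B\<in>components M. U \<inter> A \<noteq> {} \<longrightarrow> U \<inter> B \<noteq> {} \<longrightarrow> A = B)"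
  proof (cases "z \<in> M")
    case False
    then show ?thesis
      using M in_components_subset by (intro exI[of _ "- M"]) blast
  next
    case True
    then obtain r where r: "r > 0" "\<And>w. w \<in> M \<Longrightarrow> dist z w < r \<Longrightarrow> connected_component M z w"
      using DC_infdist_accumulation[OF M DC] by blast
    have "A = connected_component_set M z" if A: "A \<in> components M" "ball z r \<inter> A \<noteq> {}" for A
    proof -
      obtain w where w: "w \<in> A" "dist z w < r" using A by auto
      then have "w \<in> M" using A in_components_subset by blast
      then have "connected_component M z w" using r w by blast
      moreover have "A = connected_component_set M w"
        using A(1) w by (metis componentsE connected_component_eq)
      ultimately show ?thesis by (metis connected_component_eq mem_Collect_eq)
    qed
    then show ?thesis using r by (intro exI[of _ "ball z r"]) auto
  qed
qed

theorem theorem4p20: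
  fixes M :: "(real^2) set"
  assumes "closed M" and "M \<noteq> {}"
  shows "M \<in> D2 \<longleftrightarrow> ((\<forall>C\<in>components M. C \<in> D2) \<and> discrete_system (components M))"
proof
  assume "M \<in> D2"
  then have DC: "DC_on UNIV (\<lambda>x. infdist x M)" using assms by (auto simp: D2_def)
  then have disc: "discrete_system (components M)"
    using assms by (intro DC_infdist_imp_discrete_components)
  have "C \<in> D2" if C: "C \<in> components M" for C
  proof -
    have "closed C" "C \<noteq> {}"
      using C assms closed_components in_components_nonempty by auto
    moreover have "DC_on UNIV (\<lambda>x. infdist x C)"
      \<comment> \<open>Near a point of \<open>C\<close> the distance to \<open>M\<close> is the
        required local DC function.\<close>
      by (rule DC_infdist_locally)
        (use calculation infdist_component_eq[OF assms(1) disc C] DC in metis)+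
    ultimately show ?thesis by (simp add: D2_def)
  qed
  with disc show "(\<forall>C\<in>components M. C \<in> D2) \<and> discrete_system (components M)" by blast
next
  assume *: "(\<forall>C\<in>components M. C \<in> D2) \<and> discrete_system (components M)"
  have "DC_on UNIV (\<lambda>x. infdist x M)"
  proof (rule DC_infdist_locally[OF assms])
    fix z assume "z \<in> M"
    then obtain C where C: "C \<in> components M" "z \<in> C" using Union_components[of M] by blast
    then obtain e where "e > 0" "\<And>x. x \<in> ball z e \<Longrightarrow> infdist x M = infdist x C"
      using infdist_component_eq[OF assms(1)] * by metis
    moreover have "DC_on UNIV (\<lambda>x. infdist x C)" using * C by (auto simp: D2_def)
    ultimately show "\<exists>e>0. \<exists>F. DC_on UNIV F \<and> (\<forall>x\<in>ball z e. infdist x M = F x)" by blast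
  qed
  then show "M \<in> D2" using assms by (simp add: D2_def)
qed

end
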